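(* Let $(y_k)$ be a sequence of complex numbers and let $Y_n=y_1+y_2+\cdots+y_n$. Let $m$ and $r$ be non-negative integers. If $m$ is odd, then $$\sum_{k = 1}^\infty \frac{y_k}{\prod_{j = 0}^{2m - 1} w_{k + r + j} } = v_m\sum_{k = 1}^\infty \frac{Y_k}{\prod_{j = 0}^{m - 1} w_{k + r + j}\, \prod_{j = m + 1}^{2m} w_{k + r + j}};$$ while if $m$ is even, then $$\sum_{k = 1}^\infty \frac{y_k}{\prod_{j = 0}^{2m - 1} w_{k + r + j}} = u_m\sum_{k = 1}^\infty \frac{\bigl( p\,w_{k + m + r } + 2w_{k + m + r - 1} \bigr)Y_k}{\prod_{j = 0}^{2m} w_{k + r + j}}.$$ In particular, $$\sum_{k = 1}^\infty \frac{y_k}{w_{k + r} w_{k + r + 1}} = p \sum_{k = 1}^\infty \frac{Y_k}{w_{k + r} w_{k + r + 2}}$$ and $$\sum_{k = 1}^\infty \frac{y_k}{w_{k + r} w_{k + r + 1} w_{k + r + 2} w_{k + r + 3}} = p \sum_{k = 1}^\infty \frac{\bigl(p\,w_{k + r + 2} + 2w_{k + r + 1}\bigr)Y_k}{w_{k + r} w_{k + r + 1} w_{k + r + 2}w_{k + r + 3}w_{k + r + 4}}.$$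
   Context: The sequence $(w_n)=(w_n(a,b;p))$ is the second-order recurrence sequence defined by $w_n=p\,w_{n-1}+w_{n-2}$ for $n\ge 2$, with initial values $w_0=a$ and $w_1=b$. The companion sequences $(u_n)$ and $(v_n)$ are defined by $u_0=0$, $u_1=1$, $u_n=p\,u_{n-1}+u_{n-2}$ and $v_0=2$, $v_1=p$, $v_n=p\,v_{n-1}+v_{n-2}$ for $n\ge2$.
   Formalization: Assumed: w_n is nonzero for n > r and both series converge; and, if all coefficients of Y_k on the right vanish (e.g. p = 2i, w_n = i^n, m = 2, where the identity can fail), Y_n divided by the left-hand denominator at k = n+1 tends to 0. *)

theory Defs
  imports Complex_Main
begin

fun w :: "complex \<Rightarrow> complex \<Rightarrow> complex \<Rightarrow> nat \<Rightarrow> complex" where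
  "w a b p 0 = a"
| "w a b p (Suc 0) = b"
| "w a b p (Suc (Suc n)) = p * w a b p (Suc n) + w a b p n"

fun u :: "complex \<Rightarrow> nat \<Rightarrow> complex" where
  "u p 0 = 0"
| "u p (Suc 0) = 1"
| "u p (Suc (Suc n)) = p * u p (Suc n) + u p n"

fun v :: "complex \<Rightarrow> nat \<Rightarrow> complex" where
  "v p 0 = 2"
| "v p (Suc 0) = p"
| "v p (Suc (Suc n)) = p * v p (Suc n) + v p n"

(* The sequence y starts at index 1; the value y 0 is never used. *)
definition Y :: "(nat \<Rightarrow> complex) \<Rightarrow> nat \<Rightarrow> complex" where
  "Y y n = (\<Sum>k=1..n. y k)"

(* Summation by parts leaves the term Y y n / (\<Prod>j<2*m. w a b p (n + 1 + r + j)).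
   If the coefficients of Y y k on the right-hand side of one of the identities vanish for
   all k (for example if m = 0 or p = 0), that side is 0 whatever y is, and the identity
   says precisely that this term tends to 0.  It is a hypothesis in that case only;
   otherwise convergence of the two series is all that is assumed.
   A series over k \<ge> 1 is written as a series in Suc k. *)

end

theory Submission
  imports Defs "HOL-Analysis.Harmonic_Numbers"
begin

text \<open>
  Let \<open>D k = (\<Prod>j<2*m. W (k + j))\<close> with \<open>W k = w (Suc k + r)\<close>. Summation by parts turns
  the partial sums of \<open>\<Sum> y (Suc k) / D k\<close> into the boundary term \<open>Y y n / D n\<close> plus the partial
  sums of \<open>\<Sum> Y y (Suc k) * (1 / D k - 1 / D (Suc k))\<close>. In the difference of reciprocals all
  factors but the outer two are common, so its numerator is \<open>W (k + 2*m) - W k\<close>, and this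
  equals \<open>v m * W (k + m)\<close> for odd \<open>m\<close> and \<open>u m * (p * W (k + m) + 2 * W (k + m - 1))\<close> for even
  \<open>m\<close>. These are the four identities, up to the limit of the boundary term.

  The analytic point is that this limit is 0 as soon as both series converge, unless \<open>W\<close> has period
  \<open>2*m\<close> (lemma \<open>periodic_if_summable\<close>). Convergence of both series makes the boundary term converge.
  If its limit is not 0, the terms of the second series, which are the boundary terms
  multiplied by \<open>W (k + 2*m) / W k - 1\<close>, force \<open>W (k + 2*m) / W k \<longlonglongrightarrow> 1\<close>. As \<open>W (k + 2*m)\<close> is a
  fixed linear combination of \<open>W (Suc k)\<close> and \<open>W k\<close>, either \<open>W\<close> is periodic or the quotients
  \<open>W (Suc k) / W k\<close> converge to a characteristic root \<open>\<xi>\<close> with \<open>\<xi> ^ (2*m) = 1\<close>. The other root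
  \<open>- 1 / \<xi>\<close> is then a \<open>2*m\<close>-th root of unity as well, which is compatible with
  non-periodicity only if the two roots coincide. In that case \<open>W k = \<xi> ^ k * (A + B * k)\<close>, and
  the second series diverges like the harmonic series unless \<open>B = 0\<close>, when \<open>W\<close> is again periodic.

  If \<open>W\<close> has period \<open>2*m\<close>, the coefficients on the right-hand side all vanish, and the limit of the
  boundary term is a hypothesis.
\<close>

section \<open>Identities for second-order recurrences\<close>

lemma recurrence_shift:
  fixes W :: "nat \<Rightarrow> complex"
  assumes rec: "\<And>n. W (Suc (Suc n)) = p * W (Suc n) + W n"
  shows "W (n + Suc k) = u p (Suc k) * W (Suc n) + u p k * W n"
proof (induction k arbitrary: n)
  case 0
  then show ?case by simp
next
  case (Suc k)
  have "W (n + Suc (Suc k)) = W (Suc n + Suc k)" by simp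
  also have "\<dots> = u p (Suc k) * W (Suc (Suc n)) + u p k * W (Suc n)" by (rule Suc)
  finally show ?case by (simp add: rec algebra_simps)
qed

text \<open>For odd \<open>m\<close> this is the numerator left by summation by parts. Both sides satisfy the
  recurrence in \<open>m\<close> when the middle index \<open>n + m\<close> is kept fixed, so \<open>n\<close> must vary in the
  induction; the sign absorbs running the recurrence downwards on \<open>W n\<close>.\<close>

lemma recurrence_sum_v:
  fixes W :: "nat \<Rightarrow> complex"
  assumes rec: "\<And>n. W (Suc (Suc n)) = p * W (Suc n) + W n"
  shows "W (n + 2*m) + (-1) ^ m * W n = v p m * W (n + m)"
proof (induction m arbitrary: n rule: induct_nat_012)
  case 0
  then show ?case by simp
next
  case 1
  then show ?case by (simp add: rec)
next
  case (ge2 m)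
  have "v p (Suc (Suc m)) * W (n + Suc (Suc m))
      = p * (v p (Suc m) * W (Suc n + Suc m)) + v p m * W (Suc (Suc n) + m)"
    by (simp add: algebra_simps)
  also have "\<dots> = p * (W (Suc n + 2 * Suc m) + (-1) ^ Suc m * W (Suc n))
      + (W (Suc (Suc n) + 2*m) + (-1) ^ m * W (Suc (Suc n)))"
    by (simp only: ge2)
  also have "\<dots> = W (n + 2 * Suc (Suc m)) + (-1) ^ Suc (Suc m) * W n"
    by (simp add: rec algebra_simps)
  finally show ?case by simp
qed

text \<open>The counterpart for even \<open>m\<close>. The index is shifted by one because \<open>W (n + m)\<close> plays the role
  of \<open>W (n + m - 1)\<close>.\<close>

lemma recurrence_diff_u:
  fixes W :: "nat \<Rightarrow> complex"
  assumes rec: "\<And>n. W (Suc (Suc n)) = p * W (Suc n) + W n"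
  shows "W (Suc n + 2*m) - (-1) ^ m * W (Suc n) = u p m * (p * W (Suc n + m) + 2 * W (n + m))"
proof (induction m arbitrary: n rule: induct_nat_012)
  case 0
  then show ?case by simp
next
  case 1
  then show ?case by (simp add: rec)
next
  case (ge2 m)
  have "u p (Suc (Suc m)) * (p * W (Suc n + Suc (Suc m)) + 2 * W (n + Suc (Suc m)))
      = p * (u p (Suc m) * (p * W (Suc (Suc n) + Suc m) + 2 * W (Suc n + Suc m)))
        + u p m * (p * W (Suc (Suc (Suc n)) + m) + 2 * W (Suc (Suc n) + m))"
    by (simp add: algebra_simps)
  also have "\<dots> = p * (W (Suc (Suc n) + 2 * Suc m) - (-1) ^ Suc m * W (Suc (Suc n)))
      + (W (Suc (Suc (Suc n)) + 2*m) - (-1) ^ m * W (Suc (Suc (Suc n))))"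
    by (simp only: ge2)
  also have "\<dots> = W (Suc n + 2 * Suc (Suc m)) - (-1) ^ Suc (Suc m) * W (Suc n)"
    by (simp add: rec algebra_simps)
  finally show ?case by simp
qed

lemma double_root_closed_form:
  fixes W :: "nat \<Rightarrow> complex"
  assumes rec: "\<And>n. W (Suc (Suc n)) = 2 * \<xi> * W (Suc n) + W n"
    and \<xi>: "\<xi> * \<xi> = -1"
  shows "W n = \<xi> ^ n * (W 0 + (W 1 / \<xi> - W 0) * of_nat n)"
proof (induction n rule: induct_nat_012)
  case 0
  then show ?case by simp
next
  case 1
  have "\<xi> \<noteq> 0" using \<xi> by auto
  then show ?case by simp
next
  case (ge2 n)
  define B where "B = W 1 / \<xi> - W 0"
  have "W (Suc (Suc n)) = 2 * (\<xi> * \<xi>) * \<xi> ^ n * (W 0 + B * (of_nat n + 1))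
      + \<xi> ^ n * (W 0 + B * of_nat n)"
    unfolding rec ge2[folded B_def] by (simp add: algebra_simps)
  also have "\<dots> = (\<xi> * \<xi>) * \<xi> ^ n * (W 0 + B * (of_nat n + 2))"
    unfolding \<xi> by (simp add: algebra_simps)
  finally show ?case by (simp add: B_def algebra_simps)
qed

section \<open>The boundary term\<close>

text \<open>Convergence need not be absolute, so a comparison test does not apply to \<open>f\<close> itself.
  The real part of \<open>f n / l\<close> is eventually at least \<open>1 / (2*n)\<close>, however, and has one sign.\<close>

lemma not_summable_if_times_n_tendsto:
  fixes f :: "nat \<Rightarrow> complex"
  assumes lim: "(\<lambda>n. of_nat n * f n) \<longlonglongrightarrow> l" and l: "l \<noteq> 0"
  shows "\<not> summable f"
proof
  assume "summable f"
  then have "summable (\<lambda>n. f n / l)" by (rule summable_divide)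
  then have s: "summable (\<lambda>n. 2 * Re (f n / l))" by (intro summable_mult summable_Re)
  have "(\<lambda>n. of_nat n * f n / l) \<longlonglongrightarrow> l / l" by (intro tendsto_intros lim l)
  then have "(\<lambda>n. Re (of_nat n * f n / l)) \<longlonglongrightarrow> Re (l / l)" by (rule tendsto_Re)
  then have "(\<lambda>n. Re (of_nat n * f n / l)) \<longlonglongrightarrow> 1" using l by simp
  then have "\<forall>\<^sub>F n in sequentially. 1/2 < Re (of_nat n * f n / l)"
    by (rule order_tendstoD(1)) simp
  moreover have "\<forall>\<^sub>F n in sequentially. n > (0::nat)" by (rule eventually_gt_at_top)
  ultimately have "\<forall>\<^sub>F n in sequentially. norm (inverse (real n)) \<le> 2 * Re (f n / l)"
  proof eventually_elim
    case (elim n)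
    have "Re (of_nat n * f n / l) = real n * Re (f n / l)"
      by (simp add: times_divide_eq_right[symmetric] del: times_divide_eq_right)
    with elim show ?case by (simp add: field_simps)
  qed
  then have "summable (\<lambda>n. inverse (real n))" by (rule summable_comparison_test_ev[OF _ s])
  then show False using not_summable_harmonic[where 'a = real] by simp
qed

lemma root_power:
  fixes p \<xi> :: complex
  assumes "\<xi> * \<xi> = p * \<xi> + 1"
  shows "\<xi> ^ Suc k = u p (Suc k) * \<xi> + u p k"
  using recurrence_shift[of "\<lambda>n. \<xi> ^ n" p 0 k] assms
  by (simp add: algebra_simps) (metis distrib_left mult.assoc mult.commute mult_1)

text \<open>Unless \<open>u p (2*m) = 0\<close>, the limit of \<open>W (k + 2*m) / W k\<close> determines that of
  \<open>W (Suc k) / W k\<close>, which is a root \<open>\<xi>\<close> of the characteristic equation. The value 1 makes \<open>\<xi>\<close>,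
  and then the other root \<open>- 1 / \<xi>\<close>, a \<open>2*m\<close>-th root of unity; two distinct such roots would
  give \<open>u p (2*m) = 0\<close>.\<close>

lemma periodic_or_double_root:
  fixes W :: "nat \<Rightarrow> complex"
  assumes rec: "\<And>n. W (Suc (Suc n)) = p * W (Suc n) + W n"
    and nz: "\<And>n. W n \<noteq> 0"
    and lim: "(\<lambda>k. W (k + 2*m) / W k) \<longlonglongrightarrow> 1"
  shows "(\<forall>k. W (k + 2*m) = W k) \<or> (\<exists>\<xi>. \<xi> * \<xi> = -1 \<and> p = 2 * \<xi> \<and> \<xi> ^ (2*m) = 1)"
proof (cases "m = 0")
  case True
  then show ?thesis by simp
next
  case False
  then obtain h where h: "2 * m = Suc h" by (cases "2 * m") auto
  have shift: "W (k + 2*m) = u p (Suc h) * W (Suc k) + u p h * W k" for k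
    unfolding h by (rule recurrence_shift[where W = W and p = p, OF rec])
  have quot: "W (k + 2*m) / W k = u p (Suc h) * (W (Suc k) / W k) + u p h" for k
    using nz[of k] by (simp add: shift add_divide_distrib)
  show ?thesis
  proof (cases "u p (Suc h) = 0")
    case True
    then have "u p h = 1"
      using lim quot by (simp add: LIMSEQ_const_iff)
    then show ?thesis using True shift by simp
  next
    case uh: False
    define x where "x k = W (Suc k) / W k" for k
    have "(\<lambda>k. (W (k + 2*m) / W k - u p h) / u p (Suc h)) \<longlonglongrightarrow> (1 - u p h) / u p (Suc h)"
      by (intro tendsto_intros lim uh)
    moreover have "(W (k + 2*m) / W k - u p h) / u p (Suc h) = x k" for k
      using uh by (simp add: quot x_def)
    ultimately obtain \<xi> where x: "x \<longlonglongrightarrow> \<xi>" and \<xi>: "\<xi> = (1 - u p h) / u p (Suc h)"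
      by (simp add: fun_eq_iff)
    have "x (Suc k) * x k = p * x k + 1" for k
      using nz[of k] nz[of "Suc k"] by (simp add: x_def rec field_simps)
    moreover have "(\<lambda>k. x (Suc k) * x k) \<longlonglongrightarrow> \<xi> * \<xi>"
      by (intro tendsto_mult x LIMSEQ_Suc)
    moreover have "(\<lambda>k. p * x k + 1) \<longlonglongrightarrow> p * \<xi> + 1"
      by (intro tendsto_intros x)
    ultimately have root: "\<xi> * \<xi> = p * \<xi> + 1"
      by (metis (no_types, lifting) LIMSEQ_unique ext)
    then have "\<xi> \<noteq> 0" by auto
    have "(- 1 / \<xi>) * (- 1 / \<xi>) - (p * (- 1 / \<xi>) + 1) = (1 + p * \<xi> - \<xi> * \<xi>) / (\<xi> * \<xi>)"
      using \<open>\<xi> \<noteq> 0\<close> by (simp add: field_simps)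
    then have root': "(- 1 / \<xi>) * (- 1 / \<xi>) = p * (- 1 / \<xi>) + 1"
      using root by simp
    have pow: "\<xi> ^ (2*m) = 1"
      unfolding h root_power[OF root] using uh by (simp add: \<xi>)
    then have "(- 1 / \<xi>) ^ (2*m) = 1"
      by (simp add: power_divide)
    then have "u p (Suc h) * \<xi> + u p h = u p (Suc h) * (- 1 / \<xi>) + u p h"
      using pow root_power[OF root, of h] root_power[OF root', of h] by (simp only: h)
    then have "\<xi> = - 1 / \<xi>" using uh by (simp only: add_right_cancel mult_left_cancel[OF uh])
    then have sq: "\<xi> * \<xi> = -1" using \<open>\<xi> \<noteq> 0\<close> by (simp add: field_simps)
    moreover have "p = 2 * \<xi>"
    proof -
      have "p * \<xi> = \<xi> * \<xi> - 1" by (simp add: root)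
      also have "\<dots> = 2 * (\<xi> * \<xi>)" unfolding sq by simp
      finally show ?thesis using \<open>\<xi> \<noteq> 0\<close> by simp
    qed
    ultimately show ?thesis using pow by blast
  qed
qed

text \<open>A nonzero limit of \<open>T\<close> transfers the convergence of the series to the factor
  \<open>W (k + 2*m) / W k - 1\<close> closely enough: this factor must tend to 0, and when it is
  asymptotic to \<open>2*m / k\<close> with \<open>m \<noteq> 0\<close>, as for a double root with \<open>B \<noteq> 0\<close>, the series diverges.\<close>

lemma periodic_if_summable:
  fixes W T :: "nat \<Rightarrow> complex"
  assumes rec: "\<And>n. W (Suc (Suc n)) = p * W (Suc n) + W n"
    and nz: "\<And>n. W n \<noteq> 0"
    and T: "T \<longlonglongrightarrow> L" and L: "L \<noteq> 0"
    and sum: "summable (\<lambda>k. T k * (W (k + 2*m) / W k - 1))"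
  shows "W (k + 2*m) = W k"
proof -
  have "(\<lambda>k. T k * (W (k + 2*m) / W k - 1) / T k) \<longlonglongrightarrow> 0 / L"
    by (intro tendsto_intros summable_LIMSEQ_zero sum T L)
  moreover have "\<forall>\<^sub>F k in sequentially. T k \<noteq> 0"
    by (rule tendsto_imp_eventually_ne[OF T L])
  then have "\<forall>\<^sub>F k in sequentially.
      T k * (W (k + 2*m) / W k - 1) / T k = W (k + 2*m) / W k - 1"
    by eventually_elim simp
  ultimately have "(\<lambda>k. W (k + 2*m) / W k - 1) \<longlonglongrightarrow> 0"
    by (simp add: tendsto_cong)
  then have lim: "(\<lambda>k. W (k + 2*m) / W k) \<longlonglongrightarrow> 1"
    by (simp add: LIM_zero_iff)
  from periodic_or_double_root[OF rec nz lim] show ?thesis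
  proof (elim disjE exE conjE)
    fix \<xi> assume \<xi>: "\<xi> * \<xi> = -1" "p = 2 * \<xi>" "\<xi> ^ (2*m) = 1"
    define A B where "A = W 0" and "B = W 1 / \<xi> - W 0"
    have W: "W n = \<xi> ^ n * (A + B * of_nat n)" for n
      unfolding A_def B_def by (rule double_root_closed_form[OF _ \<xi>(1)]) (simp add: rec \<xi>(2))
    have quot: "W (n + 2*m) / W n - 1 = 2 * of_nat m * B / (A + B * of_nat n)" for n
    proof -
      have "\<xi> \<noteq> 0" "A + B * of_nat n \<noteq> 0" using \<xi>(1) nz[of n] by (auto simp: W)
      moreover have "W (n + 2*m) = \<xi> ^ n * (A + B * of_nat n + 2 * of_nat m * B)"
        unfolding W[of "n + 2*m"] power_add \<xi>(3) by (simp add: algebra_simps)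
      ultimately have "W (n + 2*m) / W n
          = (A + B * of_nat n + 2 * of_nat m * B) / (A + B * of_nat n)"
        by (simp add: W[of n])
      then show ?thesis
        using \<open>A + B * of_nat n \<noteq> 0\<close> by (simp add: add_divide_distrib[of "A + B * of_nat n"])
    qed
    have "m = 0 \<or> B = 0"
    proof (rule ccontr)
      assume "\<not> (m = 0 \<or> B = 0)"
      then have m: "m \<noteq> 0" and B: "B \<noteq> 0" by auto
      have "(\<lambda>n. T n * (2 * of_nat m * B / (A * inverse (of_nat n) + B)))
          \<longlonglongrightarrow> L * (2 * of_nat m * B / (A * 0 + B))"
        using B by (intro tendsto_intros T lim_inverse_n) simp
      moreover have "\<forall>\<^sub>F n in sequentially.
          T n * (2 * of_nat m * B / (A * inverse (of_nat n) + B))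
          = of_nat n * (T n * (W (n + 2*m) / W n - 1))"
        using eventually_gt_at_top[of 0]
      proof eventually_elim
        case (elim n)
        then have n: "of_nat n \<noteq> (0::complex)" by simp
        have "A * inverse (of_nat n) + B = (A + B * of_nat n) / of_nat n"
          using n by (simp add: field_simps)
        then show ?case by (simp add: quot)
      qed
      ultimately have "(\<lambda>n. of_nat n * (T n * (W (n + 2*m) / W n - 1))) \<longlonglongrightarrow> L * (2 * of_nat m)"
        using B by (simp add: tendsto_cong)
      moreover have "L * (2 * of_nat m) \<noteq> 0" using L m by simp
      ultimately have "\<not> summable (\<lambda>n. T n * (W (n + 2*m) / W n - 1))"
        by (rule not_summable_if_times_n_tendsto)
      then show False using sum by contradiction
    qed
    then show "W (k + 2*m) = W k"
      using quot[of k] nz[of k] by (auto simp: field_simps)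
  qed simp
qed

section \<open>Summation by parts\<close>

lemma Y_Suc: "Y y (Suc n) = Y y n + y (Suc n)"
  by (simp add: Y_def)

lemma summation_by_parts:
  fixes D :: "nat \<Rightarrow> complex"
  shows "(\<Sum>k<n. y (Suc k) / D k)
    = Y y n / D n + (\<Sum>k<n. Y y (Suc k) * (1 / D k - 1 / D (Suc k)))"
proof (induction n)
  case 0
  then show ?case by (simp add: Y_def)
next
  case (Suc n)
  have "Y y n / D n + y (Suc n) / D n = Y y (Suc n) / D n"
    by (simp add: Y_Suc add_divide_distrib)
  with Suc show ?case by (simp add: algebra_simps)
qed

text \<open>The common form of the four identities: \<open>c * g k\<close> stands for the numerator
  \<open>W (k + 2*m) - W k\<close>, so that \<open>\<forall>k. c * g k = 0\<close> means that \<open>W\<close> has period \<open>2*m\<close>. The constant is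
  kept apart from \<open>g\<close> because the identities have it in front of the series.\<close>

lemma suminf_by_parts:
  fixes W :: "nat \<Rightarrow> complex"
  assumes rec: "\<And>n. W (Suc (Suc n)) = p * W (Suc n) + W n"
    and nz: "\<And>n. W n \<noteq> 0"
    and num: "\<And>k. W (k + 2*m) - W k = c * g k"
    and sum1: "summable (\<lambda>k. y (Suc k) / (\<Prod>j<2*m. W (k + j)))"
    and sum2: "summable (\<lambda>k. g k * Y y (Suc k) / (\<Prod>j\<le>2*m. W (k + j)))"
    and bdry: "(\<forall>k. c * g k = 0) \<Longrightarrow> (\<lambda>n. Y y n / (\<Prod>j<2*m. W (n + j))) \<longlonglongrightarrow> 0"
  shows "(\<Sum>k. y (Suc k) / (\<Prod>j<2*m. W (k + j)))
    = c * (\<Sum>k. g k * Y y (Suc k) / (\<Prod>j\<le>2*m. W (k + j)))"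
proof -
  define D where "D k = (\<Prod>j<2*m. W (k + j))" for k
  define T where "T n = Y y n / D n" for n
  define G where "G k = Y y (Suc k) * (1 / D k - 1 / D (Suc k))" for k
  have D: "D k \<noteq> 0" for k using nz by (simp add: D_def)
  have up: "(\<Prod>j\<le>2*m. W (k + j)) = D k * W (k + 2*m)" for k
    unfolding D_def by (simp flip: lessThan_Suc_atMost)
  have down: "(\<Prod>j\<le>2*m. W (k + j)) = W k * D (Suc k)" for k
    unfolding D_def lessThan_Suc_atMost[symmetric] prod.lessThan_Suc_shift by simp
  have step: "W k * D (Suc k) = D k * W (k + 2*m)" for k
    using up down by simp
  have DSuc: "D (Suc k) = D k * W (k + 2*m) / W k" for k
    using step[of k] nz[of k] by (simp add: field_simps)
  have G: "G k = c * (g k * Y y (Suc k) / (\<Prod>j\<le>2*m. W (k + j)))" for k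
  proof -
    have "1 / D k - 1 / D (Suc k) = (W (k + 2*m) - W k) / (D k * W (k + 2*m))"
      using D[of k] nz[of k] nz[of "k + 2*m"] by (simp add: DSuc field_simps)
    then show ?thesis by (simp add: G_def num up)
  qed
  have sG: "summable G" unfolding G using sum2 by (rule summable_mult)
  have s1: "summable (\<lambda>k. y (Suc k) / D k)" using sum1 by (simp add: D_def)
  have parts: "T n = (\<Sum>k<n. y (Suc k) / D k) - (\<Sum>k<n. G k)" for n
    using summation_by_parts[of y D n] by (simp add: T_def G_def)
  define L where "L = (\<Sum>k. y (Suc k) / D k) - (\<Sum>k. G k)"
  have T: "T \<longlonglongrightarrow> L"
    unfolding parts L_def by (intro tendsto_diff summable_LIMSEQ sG s1)
  have "L = 0"
  proof (rule ccontr)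
    assume L: "L \<noteq> 0"
    have "G = (\<lambda>k. T (Suc k) * (W (k + 2*m) / W k - 1))"
    proof
      show "G k = T (Suc k) * (W (k + 2*m) / W k - 1)" for k
        using D[of k] nz[of k] nz[of "k + 2*m"] by (simp add: G_def T_def DSuc field_simps)
    qed
    then have "summable (\<lambda>k. T (Suc k) * (W (k + 2*m) / W k - 1))" using sG by simp
    then have "W (k + 2*m) = W k" for k
      by (rule periodic_if_summable[where W = W and p = p, OF rec nz LIMSEQ_Suc[OF T] L])
    then have "\<forall>k. c * g k = 0" by (simp flip: num)
    then have "T \<longlonglongrightarrow> 0" unfolding T_def D_def by (rule bdry)
    then show False using T L LIMSEQ_unique by blast
  qed
  then have "(\<Sum>k. y (Suc k) / D k) = (\<Sum>k. G k)" by (simp add: L_def)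
  also have "\<dots> = c * (\<Sum>k. g k * Y y (Suc k) / (\<Prod>j\<le>2*m. W (k + j)))"
    unfolding G using sum2 by (rule suminf_mult)
  finally show ?thesis by (simp add: D_def)
qed

section \<open>The reciprocal series of the recurrence sequence\<close>

text \<open>The factor \<open>W (k + m)\<close> of the numerator cancels against the middle factor of the
  product of length \<open>2*m + 1\<close>.\<close>

lemma reciprocal_series_odd:
  fixes a b p :: complex and y :: "nat \<Rightarrow> complex"
  assumes nz: "\<And>n. n > r \<Longrightarrow> w a b p n \<noteq> 0" and m: "odd m"
    and sum1: "summable (\<lambda>k. y (Suc k) / (\<Prod>j<2*m. w a b p (Suc k + r + j)))"
    and sum2: "summable (\<lambda>k. Y y (Suc k) /
      ((\<Prod>j<m. w a b p (Suc k + r + j)) * (\<Prod>j=m+1..2*m. w a b p (Suc k + r + j))))"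
    and bdry: "v p m = 0 \<Longrightarrow> (\<lambda>n. Y y n / (\<Prod>j<2*m. w a b p (n + 1 + r + j))) \<longlonglongrightarrow> 0"
  shows "(\<Sum>k. y (Suc k) / (\<Prod>j<2*m. w a b p (Suc k + r + j))) =
    v p m * (\<Sum>k. Y y (Suc k) /
      ((\<Prod>j<m. w a b p (Suc k + r + j)) * (\<Prod>j=m+1..2*m. w a b p (Suc k + r + j))))"
proof -
  define W where "W k = w a b p (Suc k + r)" for k
  have W: "w a b p (Suc k + r + j) = W (k + j)" for k j
    by (simp add: W_def add_ac)
  have W': "w a b p (n + 1 + r + j) = W (n + j)" for n j
    by (simp add: W_def add_ac)
  have rec: "W (Suc (Suc n)) = p * W (Suc n) + W n" for n by (simp add: W_def)
  have Wnz: "W n \<noteq> 0" for n unfolding W_def by (rule nz) simp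
  have num: "W (k + 2*m) - W k = v p m * W (k + m)" for k
    using recurrence_sum_v[of W p k m, OF rec] m by simp
  have mid: "W (k + m) * Y y (Suc k) / (\<Prod>j\<le>2*m. W (k + j))
      = Y y (Suc k) / ((\<Prod>j<m. W (k + j)) * (\<Prod>j=m+1..2*m. W (k + j)))" for k
  proof -
    have split: "{..2*m} = {..<m} \<union> insert m {m+1..2*m}" by auto
    have "(\<Prod>j\<le>2*m. W (k + j))
        = (\<Prod>j<m. W (k + j)) * (\<Prod>j\<in>insert m {m+1..2*m}. W (k + j))"
      unfolding split by (rule prod.union_disjoint) auto
    also have "(\<Prod>j\<in>insert m {m+1..2*m}. W (k + j))
        = W (k + m) * (\<Prod>j=m+1..2*m. W (k + j))" by simp
    finally show ?thesis using Wnz[of "k + m"] by simp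
  qed
  have "(\<Sum>k. y (Suc k) / (\<Prod>j<2*m. W (k + j)))
      = v p m * (\<Sum>k. W (k + m) * Y y (Suc k) / (\<Prod>j\<le>2*m. W (k + j)))"
  proof (rule suminf_by_parts[OF rec Wnz num])
    show "summable (\<lambda>k. y (Suc k) / (\<Prod>j<2*m. W (k + j)))" using sum1 unfolding W .
    show "summable (\<lambda>k. W (k + m) * Y y (Suc k) / (\<Prod>j\<le>2*m. W (k + j)))"
      using sum2 unfolding W mid .
    show "(\<lambda>n. Y y n / (\<Prod>j<2*m. W (n + j))) \<longlonglongrightarrow> 0" if "\<forall>k. v p m * W (k + m) = 0"
      using bdry that Wnz unfolding W' by simp
  qed
  then show ?thesis unfolding W mid .
qed

lemma reciprocal_series_even:
  fixes a b p :: complex and y :: "nat \<Rightarrow> complex"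
  assumes nz: "\<And>n. n > r \<Longrightarrow> w a b p n \<noteq> 0" and m: "even m"
    and sum1: "summable (\<lambda>k. y (Suc k) / (\<Prod>j<2*m. w a b p (Suc k + r + j)))"
    and sum2: "summable (\<lambda>k. (p * w a b p (Suc k + m + r) + 2 * w a b p (Suc k + m + r - 1))
      * Y y (Suc k) / (\<Prod>j\<le>2*m. w a b p (Suc k + r + j)))"
    and bdry: "(\<forall>k. u p m * (p * w a b p (Suc k + m + r) + 2 * w a b p (Suc k + m + r - 1)) = 0)
      \<Longrightarrow> (\<lambda>n. Y y n / (\<Prod>j<2*m. w a b p (n + 1 + r + j))) \<longlonglongrightarrow> 0"
  shows "(\<Sum>k. y (Suc k) / (\<Prod>j<2*m. w a b p (Suc k + r + j))) =
    u p m * (\<Sum>k. (p * w a b p (Suc k + m + r) + 2 * w a b p (Suc k + m + r - 1))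
      * Y y (Suc k) / (\<Prod>j\<le>2*m. w a b p (Suc k + r + j)))"
proof -
  define W where "W k = w a b p (Suc k + r)" for k
  have W: "w a b p (Suc k + r + j) = W (k + j)" for k j
    by (simp add: W_def add_ac)
  have W': "w a b p (n + 1 + r + j) = W (n + j)" for n j
    by (simp add: W_def add_ac)
  have rec: "W (Suc (Suc n)) = p * W (Suc n) + W n" for n by (simp add: W_def)
  have Wnz: "W n \<noteq> 0" for n unfolding W_def by (rule nz) simp
  have num: "W (k + 2*m) - W k
      = u p m * (p * w a b p (Suc k + m + r) + 2 * w a b p (Suc k + m + r - 1))" for k
    using recurrence_diff_u[of "w a b p" p "k + r" m] m by (simp add: W_def add_ac)
  show ?thesis
    unfolding W
  proof (rule suminf_by_parts[OF rec Wnz num])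
    show "summable (\<lambda>k. y (Suc k) / (\<Prod>j<2*m. W (k + j)))" using sum1 unfolding W .
    show "summable (\<lambda>k. (p * w a b p (Suc k + m + r) + 2 * w a b p (Suc k + m + r - 1))
      * Y y (Suc k) / (\<Prod>j\<le>2*m. W (k + j)))" using sum2 unfolding W .
  qed (use bdry in \<open>unfold W'\<close>)
qed

theorem theorem11:
  fixes a b p :: complex and y :: "nat \<Rightarrow> complex" and m r :: nat
  assumes nz: "\<And>n. n > r \<Longrightarrow> w a b p n \<noteq> 0"
  shows
    "(odd m \<longrightarrow>
        summable (\<lambda>k. y (Suc k) / (\<Prod>j<2*m. w a b p (Suc k + r + j))) \<longrightarrow>
        summable (\<lambda>k. Y y (Suc k) /
          ((\<Prod>j<m. w a b p (Suc k + r + j)) * (\<Prod>j=m+1..2*m. w a b p (Suc k + r + j)))) \<longrightarrow>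
        (v p m = 0 \<longrightarrow>
          (\<lambda>n. Y y n / (\<Prod>j<2*m. w a b p (n + 1 + r + j))) \<longlonglongrightarrow> 0) \<longrightarrow>
        (\<Sum>k. y (Suc k) / (\<Prod>j<2*m. w a b p (Suc k + r + j))) =
          v p m * (\<Sum>k. Y y (Suc k) /
            ((\<Prod>j<m. w a b p (Suc k + r + j)) * (\<Prod>j=m+1..2*m. w a b p (Suc k + r + j)))))
     \<and>
     (even m \<longrightarrow>
        summable (\<lambda>k. y (Suc k) / (\<Prod>j<2*m. w a b p (Suc k + r + j))) \<longrightarrow>
        summable (\<lambda>k. (p * w a b p (Suc k + m + r) + 2 * w a b p (Suc k + m + r - 1)) * Y y (Suc k) /
          (\<Prod>j\<le>2*m. w a b p (Suc k + r + j))) \<longrightarrow>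
        ((\<forall>k. u p m * (p * w a b p (Suc k + m + r) + 2 * w a b p (Suc k + m + r - 1)) = 0) \<longrightarrow>
          (\<lambda>n. Y y n / (\<Prod>j<2*m. w a b p (n + 1 + r + j))) \<longlonglongrightarrow> 0) \<longrightarrow>
        (\<Sum>k. y (Suc k) / (\<Prod>j<2*m. w a b p (Suc k + r + j))) =
          u p m * (\<Sum>k. (p * w a b p (Suc k + m + r) + 2 * w a b p (Suc k + m + r - 1)) * Y y (Suc k) /
            (\<Prod>j\<le>2*m. w a b p (Suc k + r + j))))
     \<and>
     (summable (\<lambda>k. y (Suc k) / (w a b p (Suc k + r) * w a b p (Suc k + r + 1))) \<longrightarrow>
        summable (\<lambda>k. Y y (Suc k) / (w a b p (Suc k + r) * w a b p (Suc k + r + 2))) \<longrightarrow>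
        (p = 0 \<longrightarrow>
          (\<lambda>n. Y y n / (w a b p (n + 1 + r) * w a b p (n + 1 + r + 1))) \<longlonglongrightarrow> 0) \<longrightarrow>
        (\<Sum>k. y (Suc k) / (w a b p (Suc k + r) * w a b p (Suc k + r + 1))) =
          p * (\<Sum>k. Y y (Suc k) / (w a b p (Suc k + r) * w a b p (Suc k + r + 2))))
     \<and>
     (summable (\<lambda>k. y (Suc k) /
          (w a b p (Suc k + r) * w a b p (Suc k + r + 1) *
           w a b p (Suc k + r + 2) * w a b p (Suc k + r + 3))) \<longrightarrow>
        summable (\<lambda>k. (p * w a b p (Suc k + r + 2) + 2 * w a b p (Suc k + r + 1)) * Y y (Suc k) /
          (w a b p (Suc k + r) * w a b p (Suc k + r + 1) * w a b p (Suc k + r + 2) *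
           w a b p (Suc k + r + 3) * w a b p (Suc k + r + 4))) \<longrightarrow>
        ((\<forall>k. p * (p * w a b p (Suc k + r + 2) + 2 * w a b p (Suc k + r + 1)) = 0) \<longrightarrow>
          (\<lambda>n. Y y n /
            (w a b p (n + 1 + r) * w a b p (n + 1 + r + 1) *
             w a b p (n + 1 + r + 2) * w a b p (n + 1 + r + 3))) \<longlonglongrightarrow> 0) \<longrightarrow>
        (\<Sum>k. y (Suc k) /
          (w a b p (Suc k + r) * w a b p (Suc k + r + 1) *
           w a b p (Suc k + r + 2) * w a b p (Suc k + r + 3))) =
          p * (\<Sum>k. (p * w a b p (Suc k + r + 2) + 2 * w a b p (Suc k + r + 1)) * Y y (Suc k) /
            (w a b p (Suc k + r) * w a b p (Suc k + r + 1) * w a b p (Suc k + r + 2) *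
             w a b p (Suc k + r + 3) * w a b p (Suc k + r + 4))))"
proof (intro conjI impI, goal_cases)
  case 1
  then show ?case by (intro reciprocal_series_odd nz) auto
next
  case 2
  then show ?case by (intro reciprocal_series_even nz) auto
next
  case 3
  have sets: "{..<2 * 1} = {0, 1::nat}" "{..<1} = {0::nat}" "{1 + 1..2 * 1} = {2::nat}" by auto
  have prods: "(\<Prod>j\<in>{0, 1::nat}. f j) = f 0 * f 1" "(\<Prod>j\<in>{0::nat}. f j) = f 0"
    "(\<Prod>j\<in>{2::nat}. f j) = f 2" for f :: "nat \<Rightarrow> complex"
    by simp_all
  have v1: "v p 1 = p" by simp
  show ?case
    by (rule reciprocal_series_odd[of r a b p 1 y, OF nz, unfolded sets v1 prods add_0_right])
      (use 3 in \<open>simp_all only: odd_one not_False_eq_True\<close>)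
next
  case 4
  have sets: "{..<2 * 2} = {0, 1, 2, 3::nat}" "{..2 * 2} = {0, 1, 2, 3, 4::nat}" by auto
  have u2: "u p 2 = p" by (simp add: numeral_2_eq_2)
  have idx: "Suc k + 2 + r = Suc k + r + 2" "Suc k + r + 2 - 1 = Suc k + r + 1" for k by auto
  have prods: "(\<Prod>j\<in>{0, 1, 2, 3::nat}. f j) = f 0 * f 1 * f 2 * f 3"
    "(\<Prod>j\<in>{0, 1, 2, 3, 4::nat}. f j) = f 0 * f 1 * f 2 * f 3 * f 4" for f :: "nat \<Rightarrow> complex"
    by (simp_all add: mult.assoc)
  show ?case
    by (rule reciprocal_series_even[of r a b p 2 y, OF nz,
        unfolded sets u2 idx prods add_0_right])
      (use 4 in \<open>blast intro: even_numeral\<close>)+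
qed

end
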